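(* Let $Z=[\mathbf{z}_1,\ldots,\mathbf{z}_n]\in\mathbb{R}^{p\times n}$, $D\in\mathbb{R}^{p\times m}$, $\lambda_1,\lambda_2\ge0$, and let $h(X)=\frac12\|Z-DX\|_F^2+\frac{\lambda_2}{2}\|X\|_F^2$, where $h$ is assumed strongly convex. Let $r=\|D^\top D\|_2+\lambda_2$ and let $\sigma\ge r$. For each $i=1,\ldots,n$ let $\mathbf{w}_i^k=(\mathbf{y}_i^k,\mathbf{x}_i^k,\mathbf{u}_i^k)$, $k\ge0$, be the sequence in $(\mathbb{R}^m)^3$ generated from arbitrary initial points by the ADMM iteration described in the context. Then any accumulation point of $\{\mathbf{w}_i^k\}$ is a P-stationary point and also a uniquely local minimizer of $$\min_{Y,X\in\mathbb{R}^{m\times n}}\ h(X)+\lambda_1\|Y\|_0\quad\text{s.t. }Y=X;$$ that is: if for every $i$, $(\mathbf{y}_i^*,\mathbf{x}_i^*,\mathbf{u}_i^* )$ is an accumulation point of $\{\mathbf{w}_i^k\}_k$, and $Y^*,X^*,U^*$ are the matrices with columns $\mathbf{y}_i^*,\mathbf{x}_i^*,\mathbf{u}_i^*$, then $(Y^*,X^*,U^* )$ is a P-stationary point of this problem for some parameter $\alpha>0$, and $(Y^*,X^* )$ is a uniquely local minimizer of it.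
   Context: $\|\cdot\|_F$ is the Frobenius norm, $\|\cdot\|_2$ the spectral norm for matrices, $\|Y\|_0$ the number of nonzero entries. $\nabla h(X)=(D^\top D+\lambda_2I)X-D^\top Z$. ADMM iteration with penalty $\sigma>0$, for each sample $\mathbf{z}_i$: $$\mathbf{y}_i^{k+1}=\mathcal{H}_{\sqrt{2\lambda_1/\sigma}}\left(\mathbf{x}_i^k+\mathbf{u}_i^k/\sigma\right),$$ $$\mathbf{x}_i^{k+1}=\left[D^\top D+(\lambda_2+\sigma)I\right]^{-1}\left(D^\top\mathbf{z}_i-\mathbf{u}_i^k+\sigma\mathbf{y}_i^{k+1}\right),$$ $$\mathbf{u}_i^{k+1}=\mathbf{u}_i^k+\sigma(\mathbf{x}_i^{k+1}-\mathbf{y}_i^{k+1}),$$ where $\mathcal{H}_t$ acts entrywise by $\mathcal{H}_t(x)=0$ if $|x|\le t$ and $\mathcal{H}_t(x)=x$ if $|x|>t$. P-stationary point: for $\alpha>0$, $(Y^*,X^*,U^* )$ is a P-stationary point with parameter $\alpha$ if $Y^*=\operatorname{Prox}_{\alpha\lambda_1\|\cdot\|_0}(Y^*+\alpha U^* )$, $0=\nabla h(X^* )+U^*$ and $Y^*=X^*$. Here the (in general multi-valued) proximal operator is taken as the entrywise hard-thresholding map $[\operatorname{Prox}_{\alpha\lambda_1\|\cdot\|_0}(A)]_{ij}=0$ if $\frac12A_{ij}^2\le\alpha\lambda_1$ and $=A_{ij}$ if $\frac12A_{ij}^2>\alpha\lambda_1$. Uniquely local minimizer: a feasible point having a neighborhood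 in which every other feasible point has strictly larger objective value. *)

theory Defs
  imports "HOL-Analysis.Analysis"
begin

text \<open>
  A matrix with \<open>a\<close> rows and \<open>b\<close> columns has type \<open>real^'b^'a\<close>: the row index is the
  outer one. The library norm of this type is the Frobenius norm, and its inner product is
  the Frobenius inner product.
\<close>

lemma norm_matrix_eq_frobenius:
  fixes A :: "real^'b^'a"
  shows "norm A = sqrt (\<Sum>i\<in>UNIV. \<Sum>j\<in>UNIV. (A $ i $ j)\<^sup>2)"
  by (simp add: norm_vec_def L2_set_def sum_nonneg)

definition spectral_norm :: "real^'b^'a \<Rightarrow> real" where
  "spectral_norm A = onorm ((*v) A)"

definition l0_norm :: "real^'b^'a \<Rightarrow> nat" where
  "l0_norm A = card {(i, j). A $ i $ j \<noteq> 0}"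

definition strongly_convex :: "('a::real_normed_vector \<Rightarrow> real) \<Rightarrow> bool" where
  "strongly_convex f \<longleftrightarrow> (\<exists>\<mu>>0. \<forall>x y. \<forall>t\<in>{0..1}.
     f (t *\<^sub>R x + (1 - t) *\<^sub>R y)
       \<le> t * f x + (1 - t) * f y - \<mu> / 2 * t * (1 - t) * (norm (x - y))\<^sup>2)"

definition accumulation_point :: "(nat \<Rightarrow> 'a::topological_space) \<Rightarrow> 'a \<Rightarrow> bool" where
  "accumulation_point w l \<longleftrightarrow> (\<exists>s. strict_mono s \<and> (w \<circ> s) \<longlonglongrightarrow> l)"

definition uniquely_local_minimizer ::
    "('a::topological_space \<Rightarrow> real) \<Rightarrow> 'a set \<Rightarrow> 'a \<Rightarrow> bool" where
  "uniquely_local_minimizer f S x \<longleftrightarrow>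
     x \<in> S \<and> (\<exists>N. open N \<and> x \<in> N \<and> (\<forall>y\<in>S \<inter> N. y \<noteq> x \<longrightarrow> f x < f y))"

definition loss :: "real^'m^'p \<Rightarrow> real^'n^'p \<Rightarrow> real \<Rightarrow> real^'n^'m \<Rightarrow> real" where
  "loss D Z lam2 X = 1 / 2 * (norm (Z - D ** X))\<^sup>2 + lam2 / 2 * (norm X)\<^sup>2"

definition grad_loss :: "real^'m^'p \<Rightarrow> real^'n^'p \<Rightarrow> real \<Rightarrow> real^'n^'m \<Rightarrow> real^'n^'m" where
  "grad_loss D Z lam2 X = (transpose D ** D + lam2 *\<^sub>R mat 1) ** X - transpose D ** Z"

lemma inner_transpose_matrix_mult:
  fixes D :: "real^'m^'p" and A :: "real^'n^'p" and V :: "real^'n^'m"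
  shows "(transpose D ** A) \<bullet> V = A \<bullet> (D ** V)"
proof -
  have "(transpose D ** A) \<bullet> V
      = (\<Sum>i\<in>UNIV. \<Sum>j\<in>UNIV. \<Sum>k\<in>UNIV. D $ k $ i * A $ k $ j * V $ i $ j)"
    by (simp add: inner_vec_def matrix_matrix_mult_def transpose_def sum_distrib_right)
  also have "\<dots> = (\<Sum>i\<in>UNIV. \<Sum>k\<in>UNIV. \<Sum>j\<in>UNIV. D $ k $ i * A $ k $ j * V $ i $ j)"
    by (rule sum.cong[OF refl], rule sum.swap)
  also have "\<dots> = (\<Sum>k\<in>UNIV. \<Sum>i\<in>UNIV. \<Sum>j\<in>UNIV. D $ k $ i * A $ k $ j * V $ i $ j)"
    by (rule sum.swap)
  also have "\<dots> = (\<Sum>k\<in>UNIV. \<Sum>j\<in>UNIV. \<Sum>i\<in>UNIV. D $ k $ i * A $ k $ j * V $ i $ j)"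
    by (rule sum.cong[OF refl], rule sum.swap)
  also have "\<dots> = A \<bullet> (D ** V)"
    by (simp add: inner_vec_def matrix_matrix_mult_def sum_distrib_left mult_ac)
  finally show ?thesis .
qed

text \<open>The closed formula \<^const>\<open>grad_loss\<close> is the gradient of \<^const>\<open>loss\<close>.\<close>

lemma has_derivative_loss:
  fixes D :: "real^'m^'p" and Z :: "real^'n^'p"
  shows "(loss D Z lam2 has_derivative (\<lambda>V. grad_loss D Z lam2 X \<bullet> V)) (at X)"
proof -
  have lin: "linear (\<lambda>X::real^'n^'m. D ** X)"
    by (intro linearI)
      (auto simp: vec_eq_iff matrix_matrix_mult_def sum_distrib_left distrib_left sum.distrib mult_ac)
  have dD: "((\<lambda>X. D ** X) has_derivative (\<lambda>V. D ** V)) (at X)"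
    by (rule linear_imp_has_derivative[OF lin])
  have scale: "(lam2 *\<^sub>R mat 1) ** X = lam2 *\<^sub>R X"
    by (simp flip: scalar_matrix_assoc add: matrix_mul_lid)
  have sub: "transpose D ** (D ** X - Z) = transpose D ** (D ** X) - transpose D ** Z"
    by (simp add: vec_eq_iff matrix_matrix_mult_def right_diff_distrib sum_subtractf)
  have add: "(transpose D ** D + lam2 *\<^sub>R mat 1) ** X
      = (transpose D ** D) ** X + (lam2 *\<^sub>R mat 1) ** X"
    by (simp add: vec_eq_iff matrix_matrix_mult_def distrib_right sum.distrib)
  have g: "grad_loss D Z lam2 X = transpose D ** (D ** X - Z) + lam2 *\<^sub>R X"
    unfolding grad_loss_def add scale
    by (simp add: matrix_mul_assoc[symmetric] sub)
  have gV: "grad_loss D Z lam2 X \<bullet> V = (D ** X) \<bullet> (D ** V) - Z \<bullet> (D ** V) + lam2 * (X \<bullet> V)" for V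
    by (simp add: g inner_add_left inner_transpose_matrix_mult inner_diff_left)
  have "((\<lambda>X. 1 / 2 * ((Z - D ** X) \<bullet> (Z - D ** X)) + lam2 / 2 * (X \<bullet> X)) has_derivative
      (\<lambda>V. grad_loss D Z lam2 X \<bullet> V)) (at X)"
    by (auto intro!: derivative_eq_intros dD ext
        simp: gV gV[unfolded inner_commute[of "grad_loss _ _ _ _"]]
          inner_diff_left inner_diff_right inner_commute algebra_simps)
  then show ?thesis
    by (simp add: loss_def[abs_def] power2_norm_eq_inner)
qed

definition hard_threshold :: "real \<Rightarrow> real^'m \<Rightarrow> real^'m" where
  "hard_threshold t v = (\<chi> j. if \<bar>v $ j\<bar> \<le> t then 0 else v $ j)"

text \<open>
  The proximal operator of \<open>c \<parallel>\<cdot>\<parallel>\<^sub>0\<close> is multi-valued at entries with \<open>A\<^sub>i\<^sub>j\<^sup>2 / 2 = c > 0\<close>;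
  the selection made here takes the value 0 there.
\<close>

definition prox_l0 :: "real \<Rightarrow> real^'n^'m \<Rightarrow> real^'n^'m" where
  "prox_l0 c A = (\<chi> i j. if 1 / 2 * (A $ i $ j)\<^sup>2 \<le> c then 0 else A $ i $ j)"

definition P_stationary ::
    "real^'m^'p \<Rightarrow> real^'n^'p \<Rightarrow> real \<Rightarrow> real \<Rightarrow> real
      \<Rightarrow> real^'n^'m \<Rightarrow> real^'n^'m \<Rightarrow> real^'n^'m \<Rightarrow> bool" where
  "P_stationary D Z lam1 lam2 \<alpha> Y X U \<longleftrightarrow>
     Y = prox_l0 (\<alpha> * lam1) (Y + \<alpha> *\<^sub>R U) \<and> 0 = grad_loss D Z lam2 X + U \<and> Y = X"

definition admm_sequence ::
    "real^'m^'p \<Rightarrow> real \<Rightarrow> real \<Rightarrow> real \<Rightarrow> real^'p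
      \<Rightarrow> (nat \<Rightarrow> real^'m) \<Rightarrow> (nat \<Rightarrow> real^'m) \<Rightarrow> (nat \<Rightarrow> real^'m) \<Rightarrow> bool" where
  "admm_sequence D lam1 lam2 \<sigma> z y x u \<longleftrightarrow> (\<forall>k.
     y (Suc k) = hard_threshold (sqrt (2 * lam1 / \<sigma>)) (x k + u k /\<^sub>R \<sigma>) \<and>
     x (Suc k) = matrix_inv (transpose D ** D + (lam2 + \<sigma>) *\<^sub>R mat 1)
                   *v (transpose D *v z - u k + \<sigma> *\<^sub>R y (Suc k)) \<and>
     u (Suc k) = u k + \<sigma> *\<^sub>R (x (Suc k) - y (Suc k)))"

end

theory Submission
  imports Defs
begin

text \<open>
  The columns evolve independently, so fix one column and write \<open>H = D\<^sup>T D + \<lambda>\<^sub>2 I\<close>,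
  \<open>K = \<sigma> I - H\<close>, which is positive semidefinite. After the first step \<open>u = D\<^sup>T z - H x\<close>,
  so the thresholded vector \<open>V = x + u / \<sigma>\<close> equals \<open>(K x + D\<^sup>T z) / \<sigma>\<close>. The augmented
  Lagrangian is bounded below and drops by at least \<open>\<parallel>K \<Delta>x\<parallel>\<^sup>2 / (2 \<sigma>)\<close> in each step, hence
  \<open>K \<Delta>x \<longlonglongrightarrow> 0\<close> and \<open>\<Delta>V \<longlonglongrightarrow> 0\<close>. In the borderline case \<open>\<sigma> = r\<close> the kernel of \<open>K\<close> is nontrivial
  and this does not yet give \<open>\<Delta>x \<longlonglongrightarrow> 0\<close>: one has to exclude that \<open>y\<close> keeps jumping by vectors
  of the kernel. The jumps take finitely many values and \<open>K\<close> applied to them tends to 0, so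
  eventually they do lie in the kernel and are orthogonal to \<open>\<Delta>V\<close>; as thresholding is monotone,
  they vanish. Then \<open>\<Delta>y \<longlonglongrightarrow> 0\<close>, and the \<open>x\<close>-step, which is contractive in \<open>x\<close>, gives \<open>\<Delta>x \<longlonglongrightarrow> 0\<close>.

  In the limit \<open>u = - \<nabla>h(x)\<close> and \<open>y = x\<close>, and each entry satisfies either \<open>y = 0\<close> and
  \<open>\<bar>u\<bar> \<le> \<sigma> t\<close>, or \<open>u = 0\<close> and \<open>\<bar>y\<bar> \<ge> t\<close>, where \<open>t\<close> is the threshold. A limit entry can sit exactly
  at \<open>\<plusminus> t\<close>, so stationarity may fail for \<open>\<alpha> = 1 / \<sigma>\<close> but holds for \<open>\<alpha> = 1 / (2 \<sigma>)\<close>. Local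
  minimality holds because entering a new support entry costs \<open>\<lambda>\<^sub>1\<close>, while along the support the
  gradient vanishes and \<open>h\<close> is strongly convex.
\<close>

section \<open>Auxiliary inequalities and limits\<close>

text \<open>In operator terms T^2 \<le> c T. Testing positivity at
  \<open>c *\<^sub>R v - T v\<close> avoids a diagonalization.\<close>

lemma psd_norm_image_le:
  fixes T :: "'a::real_inner \<Rightarrow> 'a"
  assumes lin: "linear T" and sym: "\<And>v w. T v \<bullet> w = v \<bullet> T w"
    and psd: "\<And>v. 0 \<le> T v \<bullet> v" and le: "\<And>v. T v \<bullet> v \<le> c * (v \<bullet> v)" and c: "c > 0"
  shows "(norm (T v))\<^sup>2 \<le> c * (T v \<bullet> v)"
proof -
  interpret linear T by fact
  let ?w = "T v"
  have "0 \<le> T (c *\<^sub>R v - ?w) \<bullet> (c *\<^sub>R v - ?w)"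
    by (rule psd)
  also have "\<dots> = c\<^sup>2 * (T v \<bullet> v) - 2 * c * (?w \<bullet> ?w) + T ?w \<bullet> ?w"
    using sym[of ?w v]
    by (simp add: diff scale inner_diff_left inner_diff_right power2_eq_square inner_commute algebra_simps)
  also have "\<dots> \<le> c\<^sup>2 * (T v \<bullet> v) - 2 * c * (?w \<bullet> ?w) + c * (?w \<bullet> ?w)"
    using le[of ?w] by simp
  also have "\<dots> = c * (c * (T v \<bullet> v) - (norm ?w)\<^sup>2)"
    unfolding power2_norm_eq_inner by (simp add: power2_eq_square algebra_simps)
  finally show ?thesis
    using c by (simp add: zero_le_mult_iff)
qed

lemma halving_recurrence_tendsto_0:
  fixes a e :: "nat \<Rightarrow> real"
  assumes nonneg: "\<And>k. 0 \<le> a k" and rec: "\<And>k. a (Suc k) \<le> a k / 2 + e k"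
    and e: "e \<longlonglongrightarrow> 0"
  shows "a \<longlonglongrightarrow> 0"
proof (rule LIMSEQ_I)
  fix r :: real assume r: "r > 0"
  \<comment> \<open>Under repeated halving, errors below \<open>r / 4\<close> add up to at most
    \<open>r / 2\<close>.\<close>
  have "eventually (\<lambda>k. e k < r / 4) sequentially"
    using order_tendstoD(2)[OF e, of "r / 4"] r by simp
  then obtain N where N: "\<And>k. k \<ge> N \<Longrightarrow> e k < r / 4"
    by (auto simp: eventually_sequentially)
  have bound: "a (N + n) \<le> a N * (1 / 2) ^ n + r / 2" for n
  proof (induction n)
    case 0
    show ?case using r by simp
  next
    case (Suc n)
    show ?case
      using rec[of "N + n"] N[of "N + n"] Suc by simp
  qed
  have "(\<lambda>n. a N * (1 / 2) ^ n) \<longlonglongrightarrow> a N * 0"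
    by (intro tendsto_intros LIMSEQ_realpow_zero) auto
  then have "eventually (\<lambda>n. a N * (1 / 2) ^ n < r / 2) sequentially"
    using r by (intro order_tendstoD(2)) auto
  then obtain M where M: "\<And>n. n \<ge> M \<Longrightarrow> a N * (1 / 2) ^ n < r / 2"
    by (auto simp: eventually_sequentially)
  have "norm (a n - 0) < r" if "n \<ge> N + M" for n
  proof -
    have "M \<le> n - N" and "N + (n - N) = n" using that by auto
    then show ?thesis
      using bound[of "n - N"] M[of "n - N"] nonneg[of n] by simp
  qed
  then show "\<exists>no. \<forall>n\<ge>no. norm (a n - 0) < r" by blast
qed

lemma eventually_eq_limit_of_finite_values:
  fixes f :: "nat \<Rightarrow> 'a::t1_space"
  assumes "f \<longlonglongrightarrow> l" and "finite S" and "\<And>k. f k \<in> S"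
  shows "eventually (\<lambda>k. f k = l) sequentially"
proof -
  have "open (- (S - {l}))"
    using assms(2) by (intro open_Compl finite_imp_closed) auto
  then have "eventually (\<lambda>k. f k \<in> - (S - {l})) sequentially"
    using assms(1) by (intro topological_tendstoD) auto
  then show ?thesis
    by eventually_elim (use assms(3) in auto)
qed

section \<open>Thresholding\<close>

text \<open>
  The hard threshold is the sum of the soft threshold, which is 1-Lipschitz, and \<open>t\<close> times
  the monotone step function \<open>threshold_sign\<close>, which carries all its jumps.
\<close>

definition threshold_sign :: "real \<Rightarrow> real^'m \<Rightarrow> real^'m" where
  "threshold_sign t v = (\<chi> j. if \<bar>v $ j\<bar> \<le> t then 0 else sgn (v $ j))"

definition soft_threshold :: "real \<Rightarrow> real^'m \<Rightarrow> real^'m" where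
  "soft_threshold t v = (\<chi> j. if \<bar>v $ j\<bar> \<le> t then 0 else v $ j - t * sgn (v $ j))"

lemma hard_threshold_split:
  "hard_threshold t v = soft_threshold t v + t *\<^sub>R threshold_sign t v"
  by (simp add: vec_eq_iff hard_threshold_def soft_threshold_def threshold_sign_def)

lemma norm_soft_threshold_diff_le:
  assumes "t \<ge> 0"
  shows "norm (soft_threshold t v - soft_threshold t w) \<le> norm (v - w)"
proof (rule norm_le_componentwise_cart)
  fix j
  show "norm ((soft_threshold t v - soft_threshold t w) $ j) \<le> norm ((v - w) $ j)"
    using assms by (auto simp: soft_threshold_def sgn_if abs_if split: if_splits)
qed

lemma finite_threshold_sign_diff:
  "finite {threshold_sign t v - threshold_sign t w | v w :: real^'m. True}"
proof -
  have "finite {x :: real^'m. \<forall>j. x $ j \<in> {-1, 0, 1}}"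
  proof (rule finite_subset)
    show "{x :: real^'m. \<forall>j. x $ j \<in> {-1, 0, 1}} \<subseteq> vec_lambda ` (PiE UNIV (\<lambda>_. {-1, 0, 1}))"
    proof
      fix x :: "real^'m" assume "x \<in> {x. \<forall>j. x $ j \<in> {-1, 0, 1}}"
      then have "vec_nth x \<in> PiE UNIV (\<lambda>_. {-1, 0, 1})" by (auto simp: PiE_def extensional_def)
      then show "x \<in> vec_lambda ` (PiE UNIV (\<lambda>_. {-1, 0, 1}))"
        by (metis imageI vec_nth_inverse)
    qed
  qed (auto intro!: finite_imageI finite_PiE)
  moreover have "range (threshold_sign t :: real^'m \<Rightarrow> _) \<subseteq> {x. \<forall>j. x $ j \<in> {-1, 0, 1}}"
    by (auto simp: threshold_sign_def sgn_if split: if_splits)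
  ultimately have fin: "finite (range (threshold_sign t :: real^'m \<Rightarrow> _))"
    by (rule rev_finite_subset)
  have "{threshold_sign t v - threshold_sign t w | v w :: real^'m. True}
      \<subseteq> (\<lambda>(a, b). a - b) ` (range (threshold_sign t) \<times> range (threshold_sign t))"
    by auto
  then show ?thesis
    by (rule finite_subset) (use fin in auto)
qed

text \<open>Monotonicity makes every entrywise product nonnegative, so a zero sum makes each vanish;
  but distinct signs come from distinct arguments.\<close>

lemma threshold_sign_diff_eq_0:
  assumes t: "t > 0"
    and 0: "(threshold_sign t v - threshold_sign t w) \<bullet> (v - w) = 0"
  shows "threshold_sign t v = threshold_sign t w"
proof -
  let ?d = "\<lambda>j. (threshold_sign t v $ j - threshold_sign t w $ j) * (v $ j - w $ j)"
  have nonneg: "?d j \<ge> 0" and pos: "threshold_sign t v $ j \<noteq> threshold_sign t w $ j \<Longrightarrow> ?d j \<noteq> 0" for j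
    using t by (auto simp: threshold_sign_def sgn_if split: if_splits)
  have "(\<Sum>j\<in>UNIV. ?d j) = 0"
    using 0 by (simp add: inner_vec_def)
  then have "?d j = 0" for j
    using nonneg by (simp add: sum_nonneg_eq_0_iff)
  then show ?thesis
    using pos by (auto simp: vec_eq_iff)
qed

text \<open>One column of the l0 term, kept as a sum so that minimization splits into
  entries.\<close>

definition l0_penalty :: "real \<Rightarrow> real^'m \<Rightarrow> real" where
  "l0_penalty c v = (\<Sum>j\<in>UNIV. if v $ j = 0 then 0 else c)"

lemma l0_penalty_nonneg: "c \<ge> 0 \<Longrightarrow> l0_penalty c v \<ge> 0"
  by (auto simp: l0_penalty_def intro: sum_nonneg)

text \<open>In each entry only the value 0, at cost s v^2 / 2, and the value v, at cost c, compete;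
  the threshold is where the costs tie.\<close>

lemma hard_threshold_minimizes:
  fixes v w :: "real^'m"
  assumes c: "c \<ge> 0" and s: "s > 0"
  defines "p \<equiv> hard_threshold (sqrt (2 * c / s)) v"
  shows "l0_penalty c p + s / 2 * (norm (v - p))\<^sup>2 \<le> l0_penalty c w + s / 2 * (norm (v - w))\<^sup>2"
proof -
  have eq: "l0_penalty c q + s / 2 * (norm (v - q))\<^sup>2
      = (\<Sum>j\<in>UNIV. (if q $ j = 0 then 0 else c) + s / 2 * (v $ j - q $ j)\<^sup>2)" for q
    unfolding power2_norm_eq_inner
    by (simp add: l0_penalty_def inner_vec_def sum.distrib sum_distrib_left power2_eq_square)
  have "(if p $ j = 0 then 0 else c) + s / 2 * (v $ j - p $ j)\<^sup>2
      \<le> (if w $ j = 0 then 0 else c) + s / 2 * (v $ j - w $ j)\<^sup>2" for j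
  proof (cases "\<bar>v $ j\<bar> \<le> sqrt (2 * c / s)")
    case True
    then have "(v $ j)\<^sup>2 \<le> 2 * c / s"
      using real_sqrt_le_iff by (metis real_sqrt_abs)
    then have "s / 2 * (v $ j)\<^sup>2 \<le> c"
      using s by (simp add: field_simps)
    then show ?thesis
      using True c s by (auto simp: p_def hard_threshold_def intro: add_increasing2)
  next
    case False
    then have "(v $ j)\<^sup>2 > 2 * c / s"
      using real_sqrt_less_iff by (metis not_le real_sqrt_abs)
    then have "s / 2 * (v $ j)\<^sup>2 \<ge> c"
      using s by (simp add: field_simps)
    then show ?thesis
      using False c s by (auto simp: p_def hard_threshold_def)
  qed
  then show ?thesis
    unfolding eq by (rule sum_mono)
qed

section \<open>ADMM for a quadratic function with a hard-threshold step\<close>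

text \<open>Turns multiplier and penalty terms into a squared distance, so that the
  \<open>y\<close>-step becomes the proximal problem above.\<close>

lemma complete_square_multiplier:
  fixes q v w :: "'a::real_inner"
  assumes "s > 0"
  shows "q \<bullet> (v - w) + s / 2 * (norm (v - w))\<^sup>2
    = s / 2 * (norm ((v + q /\<^sub>R s) - w))\<^sup>2 - q \<bullet> q / (2 * s)"
proof -
  define d where "d = v - w"
  have "(norm (d + q /\<^sub>R s))\<^sup>2 = (norm d)\<^sup>2 + 2 * (q \<bullet> d) / s + q \<bullet> q / s\<^sup>2"
    unfolding power2_norm_eq_inner
    by (simp add: inner_add_left inner_add_right inner_commute[of d q] power2_eq_square divide_inverse algebra_simps)
  moreover have "v + q /\<^sub>R s - w = d + q /\<^sub>R s" by (simp add: d_def)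
  ultimately show ?thesis
    using assms by (simp add: d_def[symmetric] field_simps power2_eq_square)
qed

text \<open>One column, with H = D^T D + \<lambda>_2 I, b = D^T z and c = \<lambda>_1. The bound
  \<sigma> \<ge> r enters as \<open>le\<close>; the \<open>x\<close>-step is a linear equation, free
  of the inverse.\<close>

locale hard_threshold_admm =
  fixes H :: "real^'m \<Rightarrow> real^'m" and b :: "real^'m" and c \<sigma> lb :: real
    and y x u :: "nat \<Rightarrow> real^'m"
  assumes lin: "linear H" and sym: "H v \<bullet> w = v \<bullet> H w"
    and psd: "0 \<le> H v \<bullet> v" and le: "H v \<bullet> v \<le> \<sigma> * (v \<bullet> v)"
    and sigma: "\<sigma> > 0" and c: "c \<ge> 0"
    and lower: "lb \<le> H v \<bullet> v / 2 - b \<bullet> v"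
    and y_step: "y (Suc k) = hard_threshold (sqrt (2 * c / \<sigma>)) (x k + u k /\<^sub>R \<sigma>)"
    and x_step: "H (x (Suc k)) + \<sigma> *\<^sub>R x (Suc k) = b - u k + \<sigma> *\<^sub>R y (Suc k)"
    and u_step: "u (Suc k) = u k + \<sigma> *\<^sub>R (x (Suc k) - y (Suc k))"
begin

sublocale H: linear H by (rule lin)

definition K :: "real^'m \<Rightarrow> real^'m" where
  "K v = \<sigma> *\<^sub>R v - H v"

definition V :: "nat \<Rightarrow> real^'m" where
  "V k = x k + u k /\<^sub>R \<sigma>"

text \<open>The augmented Lagrangian in the order y, x, u, without the constant |z|^2 / 2 of the
  loss.\<close>

definition lagrangian :: "real^'m \<Rightarrow> real^'m \<Rightarrow> real^'m \<Rightarrow> real" where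
  "lagrangian w v q = H v \<bullet> v / 2 - b \<bullet> v + l0_penalty c w + q \<bullet> (v - w) + \<sigma> / 2 * (norm (v - w))\<^sup>2"

lemma linear_K: "linear K"
  unfolding K_def by (intro linearI) (auto simp: H.add H.scale algebra_simps)

sublocale K: linear K by (rule linear_K)

lemma K_sym: "K v \<bullet> w = v \<bullet> K w"
  by (simp add: K_def inner_diff_left inner_diff_right sym)

section \<open>Lower bound and descent of the augmented Lagrangian\<close>

lemma norm_H_le: "(norm (H v))\<^sup>2 \<le> \<sigma> * (H v \<bullet> v)"
  by (rule psd_norm_image_le[OF lin sym psd le sigma])

lemma norm_K_le: "(norm (K v))\<^sup>2 \<le> \<sigma> * (K v \<bullet> v)"
proof (rule psd_norm_image_le[OF linear_K K_sym])
  show "0 \<le> K v \<bullet> v" for v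
    using le[of v] by (simp add: K_def inner_diff_left)
  show "K v \<bullet> v \<le> \<sigma> * (v \<bullet> v)" for v
    using psd[of v] by (simp add: K_def inner_diff_left)
qed (rule sigma)

text \<open>The multiplier is minus the gradient after every step, but not at the arbitrary initial
  point; hence the index shifts below.\<close>

lemma u_eq: "u (Suc k) = b - H (x (Suc k))"
  using x_step[of k] by (simp add: u_step algebra_simps)

lemma V_eq: "V (Suc k) = (K (x (Suc k)) + b) /\<^sub>R \<sigma>"
  using sigma by (simp add: V_def K_def u_eq scaleR_add_right scaleR_diff_right)

text \<open>The quadratic at \<open>y\<close> is expanded exactly around \<open>x\<close>, where its
  gradient is \<open>- u\<close>; \<open>le\<close> bounds the remainder by the penalty
  term.\<close>

lemma lagrangian_lower:
  "lb \<le> lagrangian (y (Suc k)) (x (Suc k)) (u (Suc k))"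
proof -
  let ?x = "x (Suc k)" and ?w = "y (Suc k)"
  have "lb \<le> H ?w \<bullet> ?w / 2 - b \<bullet> ?w" by (rule lower)
  also have "\<dots> = H ?x \<bullet> ?x / 2 - b \<bullet> ?x + u (Suc k) \<bullet> (?x - ?w) + H (?x - ?w) \<bullet> (?x - ?w) / 2"
    using sym[of ?w ?x]
    by (simp add: u_eq H.diff inner_diff_left inner_diff_right inner_commute algebra_simps)
      (simp add: field_simps)
  also have "\<dots> \<le> lagrangian ?w ?x (u (Suc k))"
    using le[of "?x - ?w"] l0_penalty_nonneg[OF c, of ?w]
    by (simp add: lagrangian_def power2_norm_eq_inner)
  finally show ?thesis .
qed

text \<open>
  For a change \<open>d\<close> of \<open>x\<close>, the multiplier step costs \<open>(norm (H d))\<^sup>2 / \<sigma>\<close> and the \<open>x\<close>-step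
  gains \<open>(H d \<bullet> d + \<sigma> * (d \<bullet> d)) / 2\<close>; the balance is \<open>(\<sigma> - H) (\<sigma> + 2 H) / (2 \<sigma>)\<close>
  as a quadratic form, which is nonnegative exactly when \<open>H \<le> \<sigma>\<close>.
\<close>

lemma lagrangian_decrease:
  "lagrangian (y (Suc (Suc k))) (x (Suc (Suc k))) (u (Suc (Suc k)))
     + (norm (K (x (Suc (Suc k)) - x (Suc k))))\<^sup>2 / (2 * \<sigma>)
   \<le> lagrangian (y (Suc k)) (x (Suc k)) (u (Suc k))"
proof -
  define x0 where "x0 = x (Suc k)"
  define x1 where "x1 = x (Suc (Suc k))"
  define u0 where "u0 = u (Suc k)"
  define u1 where "u1 = u (Suc (Suc k))"
  define y0 where "y0 = y (Suc k)"
  define y1 where "y1 = y (Suc (Suc k))"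
  define d where "d = x1 - x0"
  note defs = x0_def x1_def u0_def u1_def y0_def y1_def d_def
  have y1: "y1 = hard_threshold (sqrt (2 * c / \<sigma>)) (x0 + u0 /\<^sub>R \<sigma>)"
    by (simp add: defs y_step)
  have yy: "lagrangian y1 x0 u0 \<le> lagrangian y0 x0 u0"
    using hard_threshold_minimizes[OF c sigma, of "x0 + u0 /\<^sub>R \<sigma>" y0]
    unfolding lagrangian_def add.assoc complete_square_multiplier[OF sigma] y1 by simp
  have x1: "H x1 + \<sigma> *\<^sub>R x1 = b - u0 + \<sigma> *\<^sub>R y1"
    by (simp only: defs x_step)
  have x1': "u0 = b + \<sigma> *\<^sub>R y1 - H x1 - \<sigma> *\<^sub>R x1"
    using x1 by (simp add: algebra_simps)
  have x0: "x0 = x1 - d" by (simp add: defs)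
  \<comment> \<open>\<open>x1\<close> exactly minimizes a quadratic with Hessian H + \<sigma>, so
    the gain is half the Hessian form of \<open>d\<close>.\<close>
  have xx: "lagrangian y1 x1 u0 = lagrangian y1 x0 u0 - (H d \<bullet> d + \<sigma> * (d \<bullet> d)) / 2"
    using sym[of d x1] unfolding lagrangian_def x0 x1' power2_norm_eq_inner
    by (simp add: H.diff inner_diff_left inner_diff_right inner_add_left inner_add_right
        inner_commute field_simps)
  have du: "u1 - u0 = - H d"
    by (simp add: defs u_eq H.diff)
  have r: "x1 - y1 = (u1 - u0) /\<^sub>R \<sigma>"
    using sigma by (simp add: defs u_step)
  have "lagrangian y1 x1 u1 = lagrangian y1 x1 u0 + (u1 - u0) \<bullet> (x1 - y1)"
    by (simp add: lagrangian_def inner_diff_left)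
  also have "(u1 - u0) \<bullet> (x1 - y1) = (norm (H d))\<^sup>2 / \<sigma>"
    unfolding r du by (simp add: power2_norm_eq_inner divide_inverse mult.commute)
  finally have uu: "lagrangian y1 x1 u1 = lagrangian y1 x1 u0 + (norm (H d))\<^sup>2 / \<sigma>" .
  \<comment> \<open>This cruder bound on the multiplier cost still leaves a net gain of
    \<open>K d \<bullet> d / 2\<close>.\<close>
  have Hd: "(norm (H d))\<^sup>2 / \<sigma> \<le> H d \<bullet> d"
    using norm_H_le[of d] sigma by (simp add: field_simps)
  have "(norm (K d))\<^sup>2 / (2 * \<sigma>) \<le> K d \<bullet> d / 2"
    using norm_K_le[of d] sigma by (simp add: field_simps)
  also have "\<dots> = (\<sigma> * (d \<bullet> d) - H d \<bullet> d) / 2"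
    by (simp add: K_def inner_diff_left)
  finally have "lagrangian y1 x1 u1 + (norm (K d))\<^sup>2 / (2 * \<sigma>) \<le> lagrangian y0 x0 u0"
    using yy xx uu Hd by (simp add: field_simps)
  then show ?thesis by (simp add: defs)
qed

lemma K_diff_x_tendsto_0: "(\<lambda>k. K (x (Suc (Suc k)) - x (Suc k))) \<longlonglongrightarrow> 0"
proof -
  define L where "L k = lagrangian (y (Suc k)) (x (Suc k)) (u (Suc k))" for k
  have dec: "(norm (K (x (Suc (Suc k)) - x (Suc k))))\<^sup>2 \<le> 2 * \<sigma> * (L k - L (Suc k))" for k
    using lagrangian_decrease[of k] sigma by (simp add: L_def field_simps)
  have "L (Suc k) \<le> L k" for k
    using order_trans[OF zero_le_power2 dec[of k]] sigma by (simp add: zero_le_mult_iff)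
  then have "decseq L" by (simp add: decseq_Suc_iff)
  moreover have "lb \<le> L k" for k
    by (simp add: L_def lagrangian_lower)
  ultimately obtain l where l: "L \<longlonglongrightarrow> l"
    by (metis decseq_convergent)
  have "(\<lambda>k. 2 * \<sigma> * (L k - L (Suc k))) \<longlonglongrightarrow> 2 * \<sigma> * (l - l)"
    by (intro tendsto_intros l LIMSEQ_Suc)
  then have "(\<lambda>k. 2 * \<sigma> * (L k - L (Suc k))) \<longlonglongrightarrow> 0" by simp
  then have "(\<lambda>k. (norm (K (x (Suc (Suc k)) - x (Suc k))))\<^sup>2) \<longlonglongrightarrow> 0"
    by (rule tendsto_sandwich[rotated 2, OF tendsto_const]) (use dec in auto)
  then show ?thesis
    by (simp add: tendsto_norm_zero_iff)
qed

section \<open>Vanishing of successive differences\<close>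

lemma bounded_linear_H: "bounded_linear H"
  using lin by (simp add: linear_conv_bounded_linear)

lemma bounded_linear_K: "bounded_linear K"
  using linear_K by (simp add: linear_conv_bounded_linear)

text \<open>The difference of two consecutive \<open>x\<close>-steps. It first carries decay from K
  \<Delta>x to K \<Delta>y, and later from \<Delta>y to \<Delta>x.\<close>

lemma diff_y_recurrence:
  "\<sigma> *\<^sub>R (y (Suc (Suc (Suc k))) - y (Suc (Suc k)))
     = H (x (Suc (Suc (Suc k))) - x (Suc (Suc k))) + \<sigma> *\<^sub>R (x (Suc (Suc (Suc k))) - x (Suc (Suc k)))
       - H (x (Suc (Suc k)) - x (Suc k))"
  using x_step[of "Suc (Suc k)"] x_step[of "Suc k"]
  by (simp add: u_eq H.diff algebra_simps)

lemma diff_V: "V (Suc (Suc k)) - V (Suc k) = K (x (Suc (Suc k)) - x (Suc k)) /\<^sub>R \<sigma>"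
  unfolding V_eq K.diff by (simp add: scaleR_add_right scaleR_diff_right)

lemma diff_V_tendsto_0: "(\<lambda>k. V (Suc (Suc k)) - V (Suc k)) \<longlonglongrightarrow> 0"
  using tendsto_scaleR[OF tendsto_const K_diff_x_tendsto_0, of "inverse \<sigma>"]
  by (simp add: diff_V)

lemma diff_y_tendsto_0: "(\<lambda>k. y (Suc (Suc (Suc k))) - y (Suc (Suc k))) \<longlonglongrightarrow> 0"
proof -
  let ?t = "sqrt (2 * c / \<sigma>)"
  let ?dx = "\<lambda>k. x (Suc (Suc k)) - x (Suc k)"
  let ?dy = "\<lambda>k. y (Suc (Suc (Suc k))) - y (Suc (Suc k))"
  let ?dV = "\<lambda>k. V (Suc (Suc k)) - V (Suc k)"
  let ?ds = "\<lambda>k. threshold_sign ?t (V (Suc (Suc k))) - threshold_sign ?t (V (Suc k))"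
  let ?df = "\<lambda>k. soft_threshold ?t (V (Suc (Suc k))) - soft_threshold ?t (V (Suc k))"
  have t: "?t \<ge> 0" using c sigma by simp
  have split: "?dy k = ?df k + ?t *\<^sub>R ?ds k" for k
    by (simp only: y_step V_def[symmetric] hard_threshold_split scaleR_diff_right) simp
  have df: "?df \<longlonglongrightarrow> 0"
    by (rule Lim_null_comparison[OF _ tendsto_norm_zero[OF diff_V_tendsto_0]])
      (auto intro!: always_eventually norm_soft_threshold_diff_le t)
  \<comment> \<open>Since \<open>K\<close> commutes with \<open>H\<close>, applying it to the
    recurrence leaves only terms in K \<Delta>x.\<close>
  have HK: "H (K v) = K (H v)" for v
    by (simp add: K_def H.diff H.scale)
  have "\<sigma> *\<^sub>R K (?dy k) = H (K (?dx (Suc k))) + \<sigma> *\<^sub>R K (?dx (Suc k)) - H (K (?dx k))" for k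
    using arg_cong[OF diff_y_recurrence[of k], of K]
    by (simp only: K.add K.diff K.scale HK H.diff H.add)
  then have "K (?dy k) = (H (K (?dx (Suc k))) + \<sigma> *\<^sub>R K (?dx (Suc k)) - H (K (?dx k))) /\<^sub>R \<sigma>" for k
    using sigma by (metis scaleR_one left_inverse less_irrefl scaleR_scaleR)
  moreover have "(\<lambda>k. (H (K (?dx (Suc k))) + \<sigma> *\<^sub>R K (?dx (Suc k)) - H (K (?dx k))) /\<^sub>R \<sigma>)
      \<longlonglongrightarrow> (H 0 + \<sigma> *\<^sub>R 0 - H 0) /\<^sub>R \<sigma>"
    by (intro tendsto_intros bounded_linear.tendsto[OF bounded_linear_H] K_diff_x_tendsto_0
        LIMSEQ_Suc[OF K_diff_x_tendsto_0])
  ultimately have Kdy: "(\<lambda>k. K (?dy k)) \<longlonglongrightarrow> 0" by (simp add: H.zero)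
  have "(\<lambda>k. K (?dy k) - K (?df k)) \<longlonglongrightarrow> 0 - K 0"
    by (intro tendsto_intros Kdy bounded_linear.tendsto[OF bounded_linear_K] df)
  then have Kds: "(\<lambda>k. K (?t *\<^sub>R ?ds k)) \<longlonglongrightarrow> 0"
    by (simp add: split K.add K.zero)
  have "eventually (\<lambda>k. K (?t *\<^sub>R ?ds k) = 0) sequentially"
  proof (rule eventually_eq_limit_of_finite_values[OF Kds])
    show "finite ((\<lambda>d. K (?t *\<^sub>R d)) ` {threshold_sign ?t v - threshold_sign ?t w | v w. True})"
      using finite_threshold_sign_diff by (rule finite_imageI)
  qed auto
  then have "eventually (\<lambda>k. ?t *\<^sub>R ?ds k = 0) sequentially"
  proof eventually_elim
    fix k assume 0: "K (?t *\<^sub>R ?ds k) = 0"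
    \<comment> \<open>The jump is in the kernel of \<open>K\<close> and \<open>?dV k\<close> in its
      range; by symmetry they are orthogonal.\<close>
    have "\<sigma> *\<^sub>R ?dV k = K (?dx k)"
      using sigma by (simp add: diff_V)
    then have "\<sigma> * (?t * (?ds k \<bullet> ?dV k)) = (?t *\<^sub>R ?ds k) \<bullet> K (?dx k)"
      by (simp flip: \<open>\<sigma> *\<^sub>R ?dV k = K (?dx k)\<close>)
    also have "\<dots> = 0"
      unfolding K_sym[symmetric] 0 by simp
    \<comment> \<open>\<open>?t = 0\<close> is the case \<open>c = 0\<close>, where the scaled jump
      is trivially zero.\<close>
    finally have "?t = 0 \<or> ?ds k \<bullet> ?dV k = 0"
      using sigma by auto
    then show "?t *\<^sub>R ?ds k = 0"
      using threshold_sign_diff_eq_0[of ?t "V (Suc (Suc k))" "V (Suc k)"] t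
      by (cases "?t = 0") (auto simp del: real_sqrt_gt_0_iff simp: less_le)
  qed
  then have "eventually (\<lambda>k. ?df k = ?dy k) sequentially"
    by eventually_elim (simp only: split add_0_right)
  then show ?thesis
    by (rule Lim_transform_eventually[OF df])
qed

text \<open>On an eigenvalue h of H the factor is h / (h + \<sigma>) \<le> 1/2. Without eigenvalues:
  e = v - w satisfies w.w \<le> w.e and |w| \<le> |e|, so |v|^2 = |w + e|^2 \<ge> 4 |w|^2.\<close>

lemma contraction:
  assumes "H w + \<sigma> *\<^sub>R w = H v"
  shows "norm w \<le> norm v / 2"
proof -
  define e where "e = v - w"
  have He: "H e = \<sigma> *\<^sub>R w"
    using assms by (simp add: e_def H.diff algebra_simps)
  have v: "v = w + e" by (simp add: e_def)
  have "\<sigma>\<^sup>2 * (w \<bullet> w) \<le> \<sigma>\<^sup>2 * (w \<bullet> e)"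
    using norm_H_le[of e] unfolding He power2_norm_eq_inner by (simp add: power2_eq_square)
  then have we: "w \<bullet> w \<le> w \<bullet> e"
    using sigma by simp
  also have "\<dots> \<le> norm w * norm e" by (rule norm_cauchy_schwarz)
  finally have "norm w \<le> norm e"
    by (cases "w = 0") (auto simp: power2_norm_eq_inner[symmetric] power2_eq_square)
  then have ee: "w \<bullet> w \<le> e \<bullet> e"
    by (simp add: norm_le)
  have "(2 * norm w)\<^sup>2 \<le> (norm v)\<^sup>2"
    using we ee
    by (simp add: v power2_norm_eq_inner power_mult_distrib inner_add_left inner_add_right inner_commute)
  then show ?thesis
    using power2_le_imp_le[of "2 * norm w" "norm v"] by simp
qed

lemma diff_x_tendsto_0: "(\<lambda>k. x (Suc (Suc k)) - x (Suc k)) \<longlonglongrightarrow> 0"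
proof -
  let ?dx = "\<lambda>k. x (Suc (Suc k)) - x (Suc k)"
  let ?dy = "\<lambda>k. y (Suc (Suc (Suc k))) - y (Suc (Suc k))"
  have inv: "norm w \<le> norm p / \<sigma>" if "H w + \<sigma> *\<^sub>R w = p" for w p
  proof -
    have "\<sigma> * (norm w)\<^sup>2 \<le> p \<bullet> w"
      using psd[of w] that[symmetric] by (simp add: inner_add_left power2_norm_eq_inner)
    also have "\<dots> \<le> norm p * norm w" by (rule norm_cauchy_schwarz)
    finally show ?thesis
      using sigma by (cases "w = 0") (auto simp: power2_eq_square field_simps)
  qed
  have inj: "w = 0" if "H w + \<sigma> *\<^sub>R w = 0" for w
    using inv[OF that] by simp
  have surj: "surj (\<lambda>w. H w + \<sigma> *\<^sub>R w)"
  proof (rule linear_inj_imp_surj)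
    show l: "linear (\<lambda>w. H w + \<sigma> *\<^sub>R w)"
      by (intro linearI) (auto simp: H.add H.scale algebra_simps)
    show "inj (\<lambda>w. H w + \<sigma> *\<^sub>R w)"
      unfolding linear_injective_0[OF l] using inj by blast
  qed
  have rec: "norm (?dx (Suc k)) \<le> norm (?dx k) / 2 + norm (?dy k)" for k
  proof -
    \<comment> \<open>\<open>w\<close> is the response to the previous change of \<open>x\<close>
      alone; the rest of the new change is driven by \<open>?dy k\<close>.\<close>
    obtain w where w: "H w + \<sigma> *\<^sub>R w = H (?dx k)" using surjD[OF surj, of "H (?dx k)"] by auto
    have "H (?dx (Suc k) - w) + \<sigma> *\<^sub>R (?dx (Suc k) - w) = \<sigma> *\<^sub>R ?dy k"
      unfolding diff_y_recurrence w[symmetric] by (simp only: H.diff scaleR_diff_right) simp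
    from inv[OF this] have "norm (?dx (Suc k) - w) \<le> norm (?dy k)"
      using sigma by simp
    with contraction[OF w] show ?thesis
      using norm_triangle_ineq2[of "?dx (Suc k)" w] by linarith
  qed
  have "(\<lambda>k. norm (?dx k)) \<longlonglongrightarrow> 0"
    by (rule halving_recurrence_tendsto_0[OF norm_ge_zero rec tendsto_norm_zero[OF diff_y_tendsto_0]])
  then show ?thesis by (rule tendsto_norm_zero_cancel)
qed

section \<open>Optimality conditions at accumulation points\<close>

lemma accumulation_point_optimality:
  assumes "accumulation_point (\<lambda>k. (y k, x k, u k)) (ys, xs, us)"
  shows "ys = xs" and "us = b - H xs"
    and "(ys $ j = 0 \<and> \<bar>us $ j\<bar> \<le> \<sigma> * sqrt (2 * c / \<sigma>))
      \<or> (us $ j = 0 \<and> \<bar>ys $ j\<bar> \<ge> sqrt (2 * c / \<sigma>))"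
proof -
  obtain s where s: "strict_mono s" and lim: "(\<lambda>k. (y (s k), x (s k), u (s k))) \<longlonglongrightarrow> (ys, xs, us)"
    using assms by (auto simp: accumulation_point_def o_def)
  have y: "(\<lambda>k. y (s k)) \<longlonglongrightarrow> ys" and x: "(\<lambda>k. x (s k)) \<longlonglongrightarrow> xs" and u: "(\<lambda>k. u (s k)) \<longlonglongrightarrow> us"
    using tendsto_fst[OF lim] tendsto_fst[OF tendsto_snd[OF lim]] tendsto_snd[OF tendsto_snd[OF lim]]
    by simp_all
  have s_top: "filterlim s at_top sequentially"
    using s by (rule filterlim_subseq)
  have shift: "(\<lambda>k. f (s k)) \<longlonglongrightarrow> l" if "(\<lambda>k. f (k + n)) \<longlonglongrightarrow> l" for f and l :: "real^'m" and n
    using filterlim_compose[OF LIMSEQ_offset[OF that] s_top] .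
  have "(\<lambda>k. u (s k) - (b - H (x (s k)))) \<longlonglongrightarrow> 0"
    by (rule shift[where n = 1]) (simp add: u_eq)
  moreover have "(\<lambda>k. u (s k) - (b - H (x (s k)))) \<longlonglongrightarrow> us - (b - H xs)"
    by (intro tendsto_intros u x bounded_linear.tendsto[OF bounded_linear_H])
  ultimately have "0 = us - (b - H xs)" by (rule LIMSEQ_unique)
  then show "us = b - H xs" by simp
  have "x (Suc (Suc k)) - y (Suc (Suc k)) = - H (x (Suc (Suc k)) - x (Suc k)) /\<^sub>R \<sigma>" for k
  proof -
    have "\<sigma> *\<^sub>R (x (Suc (Suc k)) - y (Suc (Suc k))) = - H (x (Suc (Suc k)) - x (Suc k))"
      using u_step[of "Suc k"] by (simp add: u_eq H.diff algebra_simps)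
    then have "\<sigma> *\<^sub>R (x (Suc (Suc k)) - y (Suc (Suc k))) /\<^sub>R \<sigma>
        = - H (x (Suc (Suc k)) - x (Suc k)) /\<^sub>R \<sigma>" by (simp only:)
    then show ?thesis using sigma by simp
  qed
  moreover have "(\<lambda>k. - H (x (Suc (Suc k)) - x (Suc k)) /\<^sub>R \<sigma>) \<longlonglongrightarrow> - H 0 /\<^sub>R \<sigma>"
    by (intro tendsto_intros bounded_linear.tendsto[OF bounded_linear_H] diff_x_tendsto_0)
  ultimately have "(\<lambda>k. x (s k) - y (s k)) \<longlonglongrightarrow> 0"
    by (intro shift[where n = 2]) (simp add: H.zero)
  moreover have "(\<lambda>k. x (s k) - y (s k)) \<longlonglongrightarrow> xs - ys"
    by (intro tendsto_intros x y)
  ultimately have "0 = xs - ys" by (rule LIMSEQ_unique)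
  then show yx: "ys = xs" by simp
  \<comment> \<open>The \<open>y\<close>-step relates \<open>x\<close> and \<open>u\<close> at
    \<open>s k\<close> to \<open>y\<close> one index later, so that shifted sequence must have the
    same limit.\<close>
  have "(\<lambda>k. y (Suc (s k)) - y (s k)) \<longlonglongrightarrow> 0"
    by (rule shift[where n = 2]) (simp add: diff_y_tendsto_0)
  from tendsto_add[OF this y] have y': "(\<lambda>k. y (Suc (s k))) \<longlonglongrightarrow> ys" by simp
  let ?t = "sqrt (2 * c / \<sigma>)"
  \<comment> \<open>The closure of the graph of the hard threshold, with both values allowed at the
    threshold itself.\<close>
  let ?S = "{(a, w). a = 0 \<and> \<bar>w\<bar> \<le> ?t} \<union> {(a, w). a = w \<and> ?t \<le> \<bar>w\<bar>}"
  have "closed ?S"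
    unfolding split_def
    by (intro closed_Un closed_Collect_conj closed_Collect_eq closed_Collect_le continuous_intros)
  moreover have "(y (Suc (s k)) $ j, (x (s k) + u (s k) /\<^sub>R \<sigma>) $ j) \<in> ?S" for k
    by (auto simp: y_step hard_threshold_def)
  moreover have "(\<lambda>k. (y (Suc (s k)) $ j, (x (s k) + u (s k) /\<^sub>R \<sigma>) $ j))
      \<longlonglongrightarrow> (ys $ j, (xs + us /\<^sub>R \<sigma>) $ j)"
    by (intro tendsto_intros y' x u)
  ultimately have "(ys $ j, (xs + us /\<^sub>R \<sigma>) $ j) \<in> ?S"
    by (rule closed_sequentially)
  then show "(ys $ j = 0 \<and> \<bar>us $ j\<bar> \<le> \<sigma> * ?t) \<or> (us $ j = 0 \<and> \<bar>ys $ j\<bar> \<ge> ?t)"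
    using sigma yx by (auto simp: abs_mult field_simps)
qed

end

section \<open>The matrix problem\<close>

lemma column_matrix_mult: "column i (A ** B) = A *v column i B"
  for A :: "real^'m^'p" and B :: "real^'n^'m"
  by (simp add: vec_eq_iff column_def matrix_matrix_mult_def matrix_vector_mult_def)

lemma inner_transpose_mult_vector: "(transpose D *v a) \<bullet> w = a \<bullet> (D *v w)"
  for D :: "real^'m^'p"
  by (simp add: dot_lmul_matrix transpose_matrix_vector)

lemma inner_gram_shift:
  fixes D :: "real^'m^'p"
  shows "((transpose D ** D + l *\<^sub>R mat 1) *v v) \<bullet> w = (D *v v) \<bullet> (D *v w) + l * (v \<bullet> w)"
  by (simp add: matrix_vector_mult_add_rdistrib inner_add_left inner_transpose_mult_vector
      flip: scaleR_matrix_vector_assoc matrix_vector_mul_assoc del: transpose_matrix_vector)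

text \<open>For \<open>l > 0\<close> the matrix is positive definite, so \<open>matrix_inv\<close>
  is a genuine inverse.\<close>

lemma gram_shift_mult_inv:
  fixes D :: "real^'m^'p"
  assumes "l > 0"
  defines "M \<equiv> transpose D ** D + l *\<^sub>R mat 1"
  shows "M *v (matrix_inv M *v w) = w"
proof -
  have "v = 0" if "M *v v = 0" for v
  proof -
    have "(D *v v) \<bullet> (D *v v) + l * (v \<bullet> v) = 0"
      using inner_gram_shift[of D l v v] that by (simp add: M_def)
    then have "l * (v \<bullet> v) \<le> 0"
      using inner_ge_zero[of "D *v v"] by linarith
    then show ?thesis
      using assms(1) inner_ge_zero[of v] by (simp add: mult_le_0_iff)
  qed
  then have "invertible M"
    by (simp add: invertible_left_inverse matrix_left_invertible_ker)
  then have "\<exists>A'. M ** A' = mat 1 \<and> A' ** M = mat 1"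
    by (simp add: invertible_def)
  then have "M ** matrix_inv M = mat 1 \<and> matrix_inv M ** M = mat 1"
    unfolding matrix_inv_def by (rule someI_ex)
  then show ?thesis
    by (simp add: matrix_vector_mul_assoc)
qed

section \<open>Exact expansion of the loss and local minimality\<close>

lemma matrix_add_rdistrib: "(A + B) ** C = A ** C + B ** C"
  for A B :: "real^'m^'p" and C :: "real^'n^'m"
  by (simp add: vec_eq_iff matrix_matrix_mult_def distrib_right sum.distrib)

lemma loss_add:
  "loss D Z lam2 (X + V)
    = loss D Z lam2 X + grad_loss D Z lam2 X \<bullet> V + ((norm (D ** V))\<^sup>2 + lam2 * (norm V)\<^sup>2) / 2"
  for D :: "real^'m^'p"
proof -
  have g: "grad_loss D Z lam2 X = transpose D ** (D ** X - Z) + lam2 *\<^sub>R X"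
  proof -
    have "(lam2 *\<^sub>R mat 1) ** X = lam2 *\<^sub>R X"
      by (simp flip: scalar_matrix_assoc)
    moreover have "transpose D ** (D ** X - Z) = transpose D ** (D ** X) - transpose D ** Z"
      by (simp add: vec_eq_iff matrix_matrix_mult_def right_diff_distrib sum_subtractf)
    ultimately show ?thesis
      unfolding grad_loss_def matrix_add_rdistrib by (simp add: matrix_mul_assoc)
  qed
  show ?thesis
    unfolding loss_def g power2_norm_eq_inner inner_add_left inner_transpose_matrix_mult matrix_add_ldistrib
    by (simp add: inner_add_left inner_add_right inner_diff_left inner_diff_right
        inner_commute algebra_simps)
qed

text \<open>Strong convexity at the midpoint of \<open>V\<close> and 0: in the exact expansion
  around 0 the linear terms cancel and only the quadratic part remains.\<close>

lemma quadratic_part_pos: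
  fixes D :: "real^'m^'p" and Z :: "real^'n^'p" and V :: "real^'n^'m"
  assumes sc: "strongly_convex (loss D Z lam2 :: real^'n^'m \<Rightarrow> real)" and V: "V \<noteq> 0"
  shows "(norm (D ** V))\<^sup>2 + lam2 * (norm V)\<^sup>2 > 0"
proof -
  obtain \<mu> where mu: "\<mu> > 0" and le: "\<And>x y t. t \<in> {0..1} \<Longrightarrow>
      loss D Z lam2 (t *\<^sub>R x + (1 - t) *\<^sub>R y :: real^'n^'m)
        \<le> t * loss D Z lam2 x + (1 - t) * loss D Z lam2 y - \<mu> / 2 * t * (1 - t) * (norm (x - y))\<^sup>2"
    using sc unfolding strongly_convex_def by blast
  have scale: "(norm (D ** ((1 / 2) *\<^sub>R V)))\<^sup>2 + lam2 * (norm ((1 / 2) *\<^sub>R V))\<^sup>2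
      = ((norm (D ** V))\<^sup>2 + lam2 * (norm V)\<^sup>2) / 4"
  proof -
    have "D ** ((1 / 2) *\<^sub>R V) = (1 / 2) *\<^sub>R (D ** V)"
      by (simp add: vec_eq_iff matrix_matrix_mult_def sum_distrib_left mult_ac sum_divide_distrib)
    then show ?thesis
      by (simp add: power2_eq_square field_simps)
  qed
  have "loss D Z lam2 ((1 / 2) *\<^sub>R V) \<le> loss D Z lam2 V / 2 + loss D Z lam2 0 / 2 - \<mu> / 8 * (norm V)\<^sup>2"
    using le[of "1 / 2" V 0] by simp
  then have "\<mu> / 8 * (norm V)\<^sup>2 \<le> ((norm (D ** V))\<^sup>2 + lam2 * (norm V)\<^sup>2) / 8"
    using loss_add[of D Z lam2 0 "(1 / 2) *\<^sub>R V"] loss_add[of D Z lam2 0 V]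
    unfolding scale by (simp add: field_simps)
  moreover have "\<mu> / 8 * (norm V)\<^sup>2 > 0"
    using mu V by simp
  ultimately have "0 < ((norm (D ** V))\<^sup>2 + lam2 * (norm V)\<^sup>2) / 8"
    by (rule less_le_trans[rotated])
  then show ?thesis by simp
qed

lemma uniquely_local_minimizer_l0:
  fixes D :: "real^'m^'p" and Z :: "real^'n^'p" and X :: "real^'n^'m"
  assumes lam1: "lam1 \<ge> 0" and sc: "strongly_convex (loss D Z lam2 :: real^'n^'m \<Rightarrow> real)"
    and crit: "\<And>i j. grad_loss D Z lam2 X $ i $ j \<noteq> 0 \<Longrightarrow> X $ i $ j = 0 \<and> lam1 > 0"
  shows "uniquely_local_minimizer (\<lambda>(Y, X). loss D Z lam2 X + lam1 * real (l0_norm Y))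
      {(Y, X). Y = X} (X, X)"
proof -
  let ?h = "loss D Z lam2 :: real^'n^'m \<Rightarrow> real"
  \<comment> \<open>Near \<open>X\<close> no support entry is lost and the loss drops by less than
    \<open>lam1\<close>, the price of one new entry.\<close>
  let ?P = "\<lambda>W. (\<forall>i j. X $ i $ j \<noteq> 0 \<longrightarrow> W $ i $ j \<noteq> 0) \<and> (lam1 > 0 \<longrightarrow> ?h X - lam1 < ?h W)"
  have entry: "eventually (\<lambda>W. X $ i $ j \<noteq> 0 \<longrightarrow> W $ i $ j \<noteq> 0) (nhds X)" for i j
  proof (cases "X $ i $ j = 0")
    case False
    have "((\<lambda>W. W $ i $ j) \<longlongrightarrow> X $ i $ j) (nhds X)"
      by (intro tendsto_intros filterlim_ident)
    from tendsto_imp_eventually_ne[OF this False] show ?thesis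
      by (rule eventually_mono) simp
  qed simp
  have "isCont ?h X"
    by (rule has_derivative_continuous[OF has_derivative_loss])
  then have cont: "(?h \<longlongrightarrow> ?h X) (nhds X)"
    by (simp add: continuous_at tendsto_at_iff_tendsto_nhds)
  have level: "eventually (\<lambda>W. lam1 > 0 \<longrightarrow> ?h X - lam1 < ?h W) (nhds X)"
    using order_tendstoD(1)[OF cont, of "?h X - lam1"] by (cases "lam1 > 0") auto
  have "eventually ?P (nhds X)"
    by (intro eventually_conj eventually_all_finite entry level)
  then obtain N where N: "open N" "X \<in> N" "\<And>W. W \<in> N \<Longrightarrow> ?P W"
    unfolding eventually_nhds by blast
  have "?h X + lam1 * real (l0_norm X) < ?h W + lam1 * real (l0_norm W)" if W: "W \<in> N" "W \<noteq> X" for W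
  proof -
    let ?S = "\<lambda>A :: real^'n^'m. {(i, j). A $ i $ j \<noteq> 0}"
    have sub: "?S X \<subseteq> ?S W"
      using N(3)[OF W(1)] by auto
    show ?thesis
    proof (cases "lam1 > 0 \<and> ?S X \<noteq> ?S W")
      case True
      then have "card (?S X) < card (?S W)"
        using sub by (intro psubset_card_mono finite) auto
      then have "lam1 * (real (l0_norm X) + 1) \<le> lam1 * real (l0_norm W)"
        using lam1 unfolding l0_norm_def by (intro mult_left_mono) auto
      then show ?thesis
        using N(3)[OF W(1)] True by (simp add: algebra_simps)
    next
      case False
      \<comment> \<open>Either \<open>lam1 = 0\<close> and \<open>crit\<close> forces a zero
        gradient, or the supports agree and \<open>W - X\<close> vanishes off the support.\<close>
      have "grad_loss D Z lam2 X $ i $ j * (W - X) $ i $ j = 0" for i j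
        using crit[of i j] False by (cases "grad_loss D Z lam2 X $ i $ j = 0") auto
      then have "grad_loss D Z lam2 X \<bullet> (W - X) = 0"
        by (simp only: inner_vec_def inner_real_def sum.neutral_const)
      then have "?h X < ?h W"
        using loss_add[of D Z lam2 X "W - X"] quadratic_part_pos[OF sc, of "W - X"] W(2) by simp
      moreover have "l0_norm X \<le> l0_norm W"
        unfolding l0_norm_def by (intro card_mono sub finite)
      then have "lam1 * real (l0_norm X) \<le> lam1 * real (l0_norm W)"
        using lam1 by (intro mult_left_mono) auto
      ultimately show ?thesis by linarith
    qed
  qed
  then have "\<forall>y\<in>{(Y, X). Y = X} \<inter> (N \<times> N). y \<noteq> (X, X) \<longrightarrow>
      (case (X, X) of (Y, X) \<Rightarrow> ?h X + lam1 * real (l0_norm Y))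
        < (case y of (Y, X) \<Rightarrow> ?h X + lam1 * real (l0_norm Y))"
    by auto
  then show ?thesis
    unfolding uniquely_local_minimizer_def
    using open_Times[OF N(1) N(1)] N(2) by blast
qed

text \<open>Halving 1/\<sigma> lowers the squared prox threshold 2 \<alpha> c to half of 2 c /
  \<sigma>, so a nonzero entry exactly at the ADMM threshold is kept.\<close>

lemma prox_l0_fixed_entry:
  fixes c \<sigma> a q :: real
  assumes c: "c \<ge> 0" and sigma: "\<sigma> > 0"
    and "(a = 0 \<and> \<bar>q\<bar> \<le> \<sigma> * sqrt (2 * c / \<sigma>)) \<or> (q = 0 \<and> \<bar>a\<bar> \<ge> sqrt (2 * c / \<sigma>))"
  defines "\<alpha> \<equiv> 1 / (2 * \<sigma>)"
  shows "a = (if 1 / 2 * (a + \<alpha> * q)\<^sup>2 \<le> \<alpha> * c then 0 else a + \<alpha> * q)"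
proof -
  let ?t = "sqrt (2 * c / \<sigma>)"
  have t: "?t\<^sup>2 = 2 * c / \<sigma>" using c sigma by simp
  from assms(3) show ?thesis
  proof (elim disjE conjE)
    assume "a = 0" and "\<bar>q\<bar> \<le> \<sigma> * ?t"
    then have "\<bar>\<alpha> * q\<bar> \<le> ?t / 2"
      using sigma by (simp add: \<alpha>_def abs_mult field_simps)
    then have "(\<alpha> * q)\<^sup>2 \<le> (?t / 2)\<^sup>2"
      by (simp add: abs_le_square_iff[symmetric])
    also have "\<dots> = \<alpha> * c"
      unfolding power_divide t using sigma by (simp add: \<alpha>_def field_simps)
    finally have "1 / 2 * (\<alpha> * q)\<^sup>2 \<le> \<alpha> * c"
      using zero_le_power2[of "\<alpha> * q"] by linarith
    then show ?thesis using \<open>a = 0\<close> by simp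
  next
    assume "q = 0" and a: "?t \<le> \<bar>a\<bar>"
    have "a = 0" if "1 / 2 * a\<^sup>2 \<le> \<alpha> * c"
    proof -
      have "?t\<^sup>2 \<le> a\<^sup>2" using a c sigma by (intro abs_le_square_iff[THEN iffD1]) auto
      then have "2 * (\<alpha> * c) * 2 \<le> a\<^sup>2" unfolding t by (simp add: \<alpha>_def mult.commute)
      with that have "a\<^sup>2 \<le> 0" by linarith
      then show ?thesis by simp
    qed
    then show ?thesis using \<open>q = 0\<close> by auto
  qed
qed

text \<open>The spectral norm bounds the form of D^T D, which gives H \<le> \<sigma>; the lower
  bound comes from |D v - z|^2 \<ge> 0.\<close>

lemma hard_threshold_admm_admm_sequence:
  fixes D :: "real^'m^'p"
  assumes lam1: "lam1 \<ge> 0" and lam2: "lam2 \<ge> 0" and sigma: "\<sigma> > 0"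
    and bound: "\<sigma> \<ge> spectral_norm (transpose D ** D) + lam2"
    and seq: "admm_sequence D lam1 lam2 \<sigma> z y x u"
  shows "hard_threshold_admm ((*v) (transpose D ** D + lam2 *\<^sub>R mat 1)) (transpose D *v z)
    lam1 \<sigma> (- (z \<bullet> z) / 2) y x u"
proof
  let ?H = "transpose D ** D + lam2 *\<^sub>R mat 1"
  show "(?H *v v) \<bullet> w = v \<bullet> (?H *v w)" for v w
    using inner_gram_shift[of D lam2 v w] inner_gram_shift[of D lam2 w v]
    by (simp add: inner_commute)
  show "0 \<le> (?H *v v) \<bullet> v" for v
    using lam2 by (simp add: inner_gram_shift)
  show "(?H *v v) \<bullet> v \<le> \<sigma> * (v \<bullet> v)" for v
  proof -
    have "(?H *v v) \<bullet> v = ((transpose D ** D) *v v) \<bullet> v + lam2 * (v \<bullet> v)"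
      using inner_gram_shift[of D 0 v v] inner_gram_shift[of D lam2 v v] by simp
    moreover have "((transpose D ** D) *v v) \<bullet> v \<le> norm ((transpose D ** D) *v v) * norm v"
      by (rule norm_cauchy_schwarz)
    moreover have "\<dots> \<le> (spectral_norm (transpose D ** D) * norm v) * norm v"
      unfolding spectral_norm_def
      by (intro mult_right_mono onorm matrix_vector_mul_bounded_linear) auto
    moreover have "\<dots> = spectral_norm (transpose D ** D) * (v \<bullet> v)"
      by (simp add: dot_square_norm power2_eq_square)
    moreover have "(spectral_norm (transpose D ** D) + lam2) * (v \<bullet> v) \<le> \<sigma> * (v \<bullet> v)"
      by (intro mult_right_mono bound) simp
    ultimately show ?thesis by (simp add: distrib_right)
  qed
  show "- (z \<bullet> z) / 2 \<le> (?H *v v) \<bullet> v / 2 - (transpose D *v z) \<bullet> v" for v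
  proof -
    have "0 \<le> (D *v v - z) \<bullet> (D *v v - z)" by (rule inner_ge_zero)
    also have "\<dots> = (D *v v) \<bullet> (D *v v) - 2 * (z \<bullet> (D *v v)) + z \<bullet> z"
      by (simp add: inner_diff_left inner_diff_right inner_commute)
    finally have "0 \<le> (D *v v) \<bullet> (D *v v) - 2 * (z \<bullet> (D *v v)) + z \<bullet> z" .
    moreover have "0 \<le> lam2 * (v \<bullet> v)" using lam2 by simp
    ultimately show ?thesis
      unfolding inner_gram_shift inner_transpose_mult_vector by (simp add: field_simps)
  qed
  show "y (Suc k) = hard_threshold (sqrt (2 * lam1 / \<sigma>)) (x k + u k /\<^sub>R \<sigma>)" for k
    using seq by (simp add: admm_sequence_def)
  show "u (Suc k) = u k + \<sigma> *\<^sub>R (x (Suc k) - y (Suc k))" for k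
    using seq unfolding admm_sequence_def by blast
  show "?H *v x (Suc k) + \<sigma> *\<^sub>R x (Suc k) = transpose D *v z - u k + \<sigma> *\<^sub>R y (Suc k)" for k
  proof -
    let ?M = "transpose D ** D + (lam2 + \<sigma>) *\<^sub>R mat 1"
    have x: "x (Suc k) = matrix_inv ?M *v (transpose D *v z - u k + \<sigma> *\<^sub>R y (Suc k))"
      using seq unfolding admm_sequence_def by blast
    have "?H *v x (Suc k) + \<sigma> *\<^sub>R x (Suc k) = ?M *v x (Suc k)"
      by (simp add: matrix_vector_mult_add_rdistrib scaleR_add_left
          flip: scaleR_matrix_vector_assoc)
    also have "\<dots> = transpose D *v z - u k + \<sigma> *\<^sub>R y (Suc k)"
      unfolding x by (rule gram_shift_mult_inv) (use lam2 sigma in simp)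
    finally show ?thesis .
  qed
qed (use lam1 sigma in \<open>simp_all add: matrix_vector_right_distrib matrix_vector_mult_scaleR\<close>)

theorem theorem3p1:
  fixes Z :: "real^'n^'p" and D :: "real^'m^'p"
    and lam1 lam2 \<sigma> r :: real
    and y x u :: "'n \<Rightarrow> nat \<Rightarrow> real^'m"
    and Ys Xs Us :: "real^'n^'m"
  assumes "lam1 \<ge> 0" and "lam2 \<ge> 0"
    and "strongly_convex (loss D Z lam2 :: real^'n^'m \<Rightarrow> real)"
    and "r = spectral_norm (transpose D ** D) + lam2"
    and "\<sigma> > 0" and "\<sigma> \<ge> r"
    and "\<And>i. admm_sequence D lam1 lam2 \<sigma> (column i Z) (y i) (x i) (u i)"
    and "\<And>i. accumulation_point (\<lambda>k. (y i k, x i k, u i k))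
               (column i Ys, column i Xs, column i Us)"
  shows "(\<exists>\<alpha>>0. P_stationary D Z lam1 lam2 \<alpha> Ys Xs Us) \<and>
    uniquely_local_minimizer
      (\<lambda>(Y, X). loss D Z lam2 X + lam1 * real (l0_norm Y))
      {(Y, X). Y = X} (Ys, Xs)"
proof -
  let ?t = "sqrt (2 * lam1 / \<sigma>)"
  note admm = hard_threshold_admm_admm_sequence[OF assms(1,2,5) assms(6)[unfolded assms(4)] assms(7)]
  note opt = hard_threshold_admm.accumulation_point_optimality[OF admm assms(8)]
  have col: "A $ j $ i = column i A $ j" for A :: "real^'n^'m" and i j
    by (simp add: column_def)
  have YX: "Ys = Xs"
    using opt(1) by (simp add: vec_eq_iff col)
  have entries: "(Ys $ j $ i = 0 \<and> \<bar>Us $ j $ i\<bar> \<le> \<sigma> * ?t) \<or> (Us $ j $ i = 0 \<and> ?t \<le> \<bar>Ys $ j $ i\<bar>)" for i j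
    using opt(3)[of i j] by (simp only: col)
  have "column i (grad_loss D Z lam2 Xs)
      = (transpose D ** D + lam2 *\<^sub>R mat 1) *v column i Xs - transpose D *v column i Z" for i
    unfolding grad_loss_def column_matrix_mult[symmetric] by (simp add: vec_eq_iff column_def)
  then have grad: "grad_loss D Z lam2 Xs = - Us"
    using opt(2) by (simp add: vec_eq_iff col)
  let ?\<alpha> = "1 / (2 * \<sigma>)"
  have "Ys = prox_l0 (?\<alpha> * lam1) (Ys + ?\<alpha> *\<^sub>R Us)"
    using prox_l0_fixed_entry[OF assms(1,5) entries]
    by (simp only: prox_l0_def vec_eq_iff vec_lambda_beta vector_add_component
        vector_scaleR_component real_scaleR_def) blast
  then have "P_stationary D Z lam1 lam2 ?\<alpha> Ys Xs Us"
    unfolding P_stationary_def by (simp add: grad YX)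
  moreover have "?\<alpha> > 0" using assms(5) by simp
  moreover have "uniquely_local_minimizer (\<lambda>(Y, X). loss D Z lam2 X + lam1 * real (l0_norm Y))
      {(Y, X). Y = X} (Xs, Xs)"
  proof (rule uniquely_local_minimizer_l0[OF assms(1,3)])
    fix j i assume "grad_loss D Z lam2 Xs $ j $ i \<noteq> 0"
    then have "Us $ j $ i \<noteq> 0" by (simp add: grad)
    \<comment> \<open>A nonzero multiplier rules out the second alternative, and its bound in the
      first makes the threshold positive.\<close>
    with entries[of j i] have "Xs $ j $ i = 0" and "0 < \<sigma> * ?t"
      by (auto simp only: YX)
    then show "Xs $ j $ i = 0 \<and> lam1 > 0"
      using assms(5) by (simp add: zero_less_mult_iff zero_less_divide_iff)
  qed
  ultimately show ?thesis
    using YX by blast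
qed

end
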